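(* Let $N>1$ be an integer and $A,B,X,Y\subseteq\mathbb{Z}_N = \mathbb{Z}/N\mathbb{Z}$. The pair $A,B$ admits cross tiling with complements $X,Y$ if and only if all of the following hold: $$(\widehat{A}(0)+\widehat{B}(0))(\widehat{X}(0)+\widehat{Y}(0)) = 2N,$$ $$\forall k\in\mathbb{Z}_N\setminus\{0\}:\quad \widehat{A}(k)\neq-\widehat{B}(k)\ \Longrightarrow\ \widehat{X}(k) = -\widehat{Y}(k),$$ $$\forall k\in\mathbb{Z}_N:\quad \widehat{A}(k)\neq\widehat{B}(k)\ \Longrightarrow\ \widehat{X}(k)=\widehat{Y}(k).$$ In particular, if the pair $A,B$ admits cross tiling with complements $X,Y$ then $|A|=|B|$ or $|X|=|Y|$.
   Context: The pair $A,B\subseteq\mathbb{Z}_N$ admits cross tiling with complements $X,Y\subseteq\mathbb{Z}_N$ if both $\mathbb{Z}_N = (A+X)\cup(B+Y)$ and $\mathbb{Z}_N = (A+Y)\cup(B+X)$ are tilings, where the first means that every element of $\mathbb{Z}_N$ is represented exactly once in total, either as $a+x$ with $(a,x)\in A\times X$ or as $b+y$ with $(b,y)\in B\times Y$, and similarly for the second. Equivalently, $\mathbf 1_A*\mathbf 1_X+\mathbf 1_B*\mathbf 1_Y\equiv1$ and $\mathbf 1_A*\mathbf 1_Y+\mathbf 1_B*\mathbf 1_X\equiv1$ on $\mathbb{Z}_N$. For $S\subseteq\mathbb{Z}_N$, $\widehat{S}(k) = \sum_{s\in S}e^{-2\pi i ks/N}$ is the Fourier transform of the indicator function of $S$. 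*)

theory Defs
  imports Complex_Main "HOL-Number_Theory.Residues"
begin

text \<open>\<open>\<int>\<^sub>N\<close> is \<open>residue_ring N\<close>, so its elements are the integers \<open>0, \<dots>, N - 1\<close>.\<close>

definition is_tiling :: "int \<Rightarrow> int set \<Rightarrow> int set \<Rightarrow> int set \<Rightarrow> int set \<Rightarrow> bool" where
  "is_tiling N A X B Y \<longleftrightarrow>
     (\<forall>z \<in> carrier (residue_ring N).
        card {(a, x). a \<in> A \<and> x \<in> X \<and> a \<oplus>\<^bsub>residue_ring N\<^esub> x = z}
      + card {(b, y). b \<in> B \<and> y \<in> Y \<and> b \<oplus>\<^bsub>residue_ring N\<^esub> y = z} = 1)"

definition cross_tiling :: "int \<Rightarrow> int set \<Rightarrow> int set \<Rightarrow> int set \<Rightarrow> int set \<Rightarrow> bool" where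
  "cross_tiling N A B X Y \<longleftrightarrow> is_tiling N A X B Y \<and> is_tiling N A Y B X"

definition fourier :: "int \<Rightarrow> int set \<Rightarrow> int \<Rightarrow> complex" where
  "fourier N S k =
     (\<Sum>s\<in>S. exp (- (2 * of_real pi * \<i> * of_int k * of_int s / of_int N)))"

end

theory Submission
  imports Defs "HOL-Analysis.Complex_Transcendental"
begin

text \<open>
  The Fourier transform \<open>F\<close> turns convolution into multiplication and is injective, so a tiling
  amounts to \<open>FA FX + FB FY = N \<delta>\<^sub>0\<close>, and a cross tiling to this together with
  \<open>FA FY + FB FX = N \<delta>\<^sub>0\<close>. Sum and difference of the two equations factor as
  \<open>(FA + FB) (FX + FY) = 2 N \<delta>\<^sub>0\<close> and \<open>(FA - FB) (FX - FY) = 0\<close>.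
\<close>

definition zchar :: "int \<Rightarrow> int \<Rightarrow> int \<Rightarrow> complex" where
  "zchar N k s = exp (- (2 * of_real pi * \<i> * of_int k * of_int s / of_int N))"

lemma fourier_eq_sum_zchar: "fourier N S k = (\<Sum>s\<in>S. zchar N k s)"
  by (simp add: fourier_def zchar_def)

lemma zchar_zero_left [simp]: "zchar N 0 s = 1"
  by (simp add: zchar_def)

lemma zchar_commute: "zchar N k s = zchar N s k"
  by (simp add: zchar_def mult_ac)

lemma zchar_add: "zchar N k (s + t) = zchar N k s * zchar N k t"
  by (simp add: zchar_def exp_add [symmetric] add_divide_distrib algebra_simps)

lemma zchar_mult_of_nat: "zchar N k (s * int n) = zchar N k s ^ n"
  by (simp add: zchar_def exp_of_nat_mult [symmetric] algebra_simps)

lemma zchar_eq_1_iff: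
  assumes "N > 0"
  shows "zchar N k s = 1 \<longleftrightarrow> N dvd k * s"
proof -
  let ?x = "- (2 * of_real pi * \<i> * of_int k * of_int s / of_int N) :: complex"
  have x: "?x = complex_of_real (- (2 * pi * k * s / N)) * \<i>"
    by simp
  have "zchar N k s = 1 \<longleftrightarrow> (\<exists>n::int. - (2 * pi * k * s / N) = of_int (2 * n) * pi)"
    unfolding zchar_def exp_eq_1 x by simp
  \<comment> \<open>The minus sign is the one in the exponent of \<open>zchar\<close>. The equations
    match for each \<open>n\<close> separately, so no witness has to be transformed.\<close>
  also have "\<dots> \<longleftrightarrow> (\<exists>n::int. k * s = N * (- n))"
  proof (rule arg_cong [where f = Ex], rule ext)
    fix n :: int
    have "- (2 * pi * k * s / N) = of_int (2 * n) * pi \<longleftrightarrow>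
        pi * (of_int k * of_int s) = pi * (of_int N * of_int (- n))"
      using assms by (auto simp: field_simps)
    also have "\<dots> \<longleftrightarrow> real_of_int (k * s) = of_int (N * (- n))"
      by (simp only: mult_cancel_left pi_neq_zero of_int_mult simp_thms)
    finally show "- (2 * pi * k * s / N) = of_int (2 * n) * pi \<longleftrightarrow> k * s = N * (- n)"
      by (simp only: of_int_eq_iff)
  qed
  also have "\<dots> \<longleftrightarrow> N dvd k * s"
    by (metis add.inverse_inverse dvd_def)
  finally show ?thesis .
qed

text \<open>The multiple of \<open>N\<close> split off by division contributes a factor 1. So
  characters turn the reduced addition of \<open>residue_ring N\<close> into multiplication.\<close>

lemma zchar_mod:
  assumes "N > 0"
  shows "zchar N k (s mod N) = zchar N k s"
proof -
  have "zchar N k s = zchar N k (N * (s div N)) * zchar N k (s mod N)"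
    by (simp flip: zchar_add)
  also have "zchar N k (N * (s div N)) = 1"
    using assms by (simp add: zchar_eq_1_iff)
  finally show ?thesis
    by simp
qed

text \<open>Orthogonality of characters: this is a geometric sum whose ratio
  \<open>zchar N k 1\<close> is an N-th root of unity, equal to 1 exactly when \<open>N\<close>
  divides \<open>k\<close>.\<close>

lemma sum_zchar:
  assumes "N > 0"
  shows "(\<Sum>z\<in>{0..N-1}. zchar N k z) = (if N dvd k then of_int N else 0)"
proof -
  let ?w = "zchar N k 1"
  have "(\<Sum>z\<in>{0..N-1}. zchar N k z) = (\<Sum>n<nat N. ?w ^ n)"
    by (rule sum.reindex_bij_witness [of _ int nat])
      (use assms zchar_mult_of_nat [of N k 1, symmetric] in auto)
  also have "\<dots> = (if N dvd k then of_int N else 0)"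
  proof (cases "?w = 1")
    case True
    moreover from True assms have "N dvd k"
      by (simp add: zchar_eq_1_iff)
    ultimately show ?thesis
      using assms by simp
  next
    case False
    have "?w ^ nat N = zchar N k N"
      using assms zchar_mult_of_nat [of N k 1 "nat N"] by simp
    then have "?w ^ nat N = 1"
      using assms by (simp add: zchar_eq_1_iff)
    with False assms show ?thesis
      by (simp add: geometric_sum zchar_eq_1_iff)
  qed
  finally show ?thesis .
qed

text \<open>Representation counts are not indicator functions, so the transform is needed for
  functions as well as for sets.\<close>

definition dft :: "int \<Rightarrow> (int \<Rightarrow> complex) \<Rightarrow> int \<Rightarrow> complex" where
  "dft N f k = (\<Sum>z\<in>{0..N-1}. f z * zchar N k z)"

lemma dft_add: "dft N (\<lambda>z. f z + g z) k = dft N f k + dft N g k"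
  by (simp add: dft_def sum.distrib algebra_simps)

text \<open>After swapping the sums, \<open>zchar_commute\<close> turns the inner sum over
  frequencies into an orthogonality sum, which only \<open>z = w\<close> survives.\<close>

lemma dft_inversion:
  assumes "N > 0" and "w \<in> {0..N-1}"
  shows "(\<Sum>k\<in>{0..N-1}. dft N f k * zchar N k (- w)) = of_int N * f w"
proof -
  have "(\<Sum>k\<in>{0..N-1}. dft N f k * zchar N k (- w)) =
      (\<Sum>k\<in>{0..N-1}. \<Sum>z\<in>{0..N-1}. f z * zchar N k (z - w))"
    by (simp add: dft_def sum_distrib_right mult.assoc flip: zchar_add)
  also have "\<dots> = (\<Sum>z\<in>{0..N-1}. f z * (\<Sum>k\<in>{0..N-1}. zchar N (z - w) k))"
    by (subst sum.swap) (simp add: sum_distrib_left zchar_commute)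
  also have "\<dots> = (\<Sum>z\<in>{0..N-1}. if z = w then of_int N * f w else 0)"
  proof (rule sum.cong [OF refl])
    fix z assume "z \<in> {0..N-1}"
    \<comment> \<open>Both points are reduced residues, so congruence modulo \<open>N\<close> is
      equality.\<close>
    with assms have "N dvd z - w \<longleftrightarrow> z = w"
      by (auto simp: mod_eq_dvd_iff [symmetric])
    with assms show "f z * (\<Sum>k\<in>{0..N-1}. zchar N (z - w) k) = (if z = w then of_int N * f w else 0)"
      by (simp add: sum_zchar)
  qed
  also have "\<dots> = of_int N * f w"
    using assms by simp
  finally show ?thesis .
qed

lemma dft_eq_iff:
  assumes "N > 0"
  shows "(\<forall>k\<in>{0..N-1}. dft N f k = dft N g k) \<longleftrightarrow> (\<forall>z\<in>{0..N-1}. f z = g z)"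
proof
  assume eq: "\<forall>k\<in>{0..N-1}. dft N f k = dft N g k"
  show "\<forall>z\<in>{0..N-1}. f z = g z"
  proof
    fix z assume z: "z \<in> {0..N-1}"
    have "of_int N * f z = of_int N * g z"
      unfolding dft_inversion [OF assms z, symmetric] using eq by (intro sum.cong) auto
    with assms show "f z = g z"
      by simp
  qed
qed (auto simp: dft_def intro: sum.cong)

text \<open>This is the convolution of the indicator functions of \<open>A\<close> and
  \<open>X\<close>, evaluated at \<open>z\<close>.\<close>

definition sum_count :: "int \<Rightarrow> int set \<Rightarrow> int set \<Rightarrow> int \<Rightarrow> nat" where
  "sum_count N A X z = card {(a, x). a \<in> A \<and> x \<in> X \<and> a \<oplus>\<^bsub>residue_ring N\<^esub> x = z}"

text \<open>Convolution theorem: grouping the pairs by their sum modulo \<open>N\<close> makes the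
  transform a sum over \<open>A \<times> X\<close>, where each character value splits into two
  factors.\<close>

lemma dft_sum_count:
  assumes "N > 0" and "finite A" and "finite X"
  shows "dft N (\<lambda>z. of_nat (sum_count N A X z)) k = fourier N A k * fourier N X k"
proof -
  let ?g = "\<lambda>(a, x). (a + x) mod N"
  have fib: "{(a, x). a \<in> A \<and> x \<in> X \<and> a \<oplus>\<^bsub>residue_ring N\<^esub> x = z} = {p \<in> A \<times> X. ?g p = z}" for z
    by (auto simp: residue_ring_def)
  have "dft N (\<lambda>z. of_nat (sum_count N A X z)) k =
      (\<Sum>z\<in>{0..N-1}. \<Sum>p\<in>{p \<in> A \<times> X. ?g p = z}. zchar N k (?g p))"
    by (simp add: dft_def sum_count_def fib)
  also have "\<dots> = (\<Sum>p\<in>A \<times> X. zchar N k (?g p))"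
    by (rule sum.group) (use assms in auto)
  also have "\<dots> = (\<Sum>(a, x)\<in>A \<times> X. zchar N k a * zchar N k x)"
    using assms by (intro sum.cong) (auto simp: zchar_mod zchar_add)
  finally show ?thesis
    by (simp add: fourier_eq_sum_zchar sum_product sum.cartesian_product)
qed

text \<open>A tiling says that two convolutions add up to the constant 1, whose transform is
  \<open>N\<close> at frequency 0 and 0 elsewhere; injectivity of the transform gives both
  directions.\<close>

lemma is_tiling_iff_fourier:
  assumes "N > 0" and "finite A" and "finite B" and "finite X" and "finite Y"
  shows "is_tiling N A X B Y \<longleftrightarrow>
    (\<forall>k\<in>{0..N-1}. fourier N A k * fourier N X k + fourier N B k * fourier N Y k =
      (if k = 0 then of_int N else 0))"
proof -
  let ?f = "\<lambda>z. of_nat (sum_count N A X z) + of_nat (sum_count N B Y z) :: complex"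
  have one: "dft N (\<lambda>z. 1) k = (if k = 0 then of_int N else 0)" if "k \<in> {0..N-1}" for k
    using that assms(1) zdvd_not_zless [of k N] by (auto simp: dft_def sum_zchar)
  have "is_tiling N A X B Y \<longleftrightarrow> (\<forall>z\<in>{0..N-1}. sum_count N A X z + sum_count N B Y z = 1)"
    by (simp add: is_tiling_def sum_count_def residue_ring_def)
  also have "\<dots> \<longleftrightarrow> (\<forall>z\<in>{0..N-1}. ?f z = 1)"
    by (metis of_nat_1 of_nat_add of_nat_eq_iff)
  also have "\<dots> \<longleftrightarrow> (\<forall>k\<in>{0..N-1}. dft N ?f k = dft N (\<lambda>z. 1) k)"
    using dft_eq_iff [OF assms(1), of ?f "\<lambda>z. 1"] by simp
  finally show ?thesis
    using assms one by (simp add: dft_add dft_sum_count)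
qed

text \<open>The left-hand sides have a sum and a difference that factor, and two complex numbers are
  determined by their sum and difference.\<close>

lemma cross_products_eq_iff:
  fixes a b x y c :: complex
  shows "a * x + b * y = c \<and> a * y + b * x = c \<longleftrightarrow>
    (a + b) * (x + y) = 2 * c \<and> (a - b) * (x - y) = 0"
proof -
  have "(a + b) * (x + y) = (a * x + b * y) + (a * y + b * x)"
    and "(a - b) * (x - y) = (a * x + b * y) - (a * y + b * x)"
    by (simp_all add: algebra_simps)
  moreover have "p = c \<and> q = c \<longleftrightarrow> p + q = 2 * c \<and> p - q = 0" for p q :: complex
    by (auto simp flip: mult_2)
  ultimately show ?thesis
    by simp
qed

text \<open>The second tiling is the first with \<open>X\<close> and \<open>Y\<close> exchanged,
  hence the order \<open>assms(5,4)\<close>.\<close>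

lemma cross_tiling_iff_fourier:
  assumes "N > 0" and "finite A" and "finite B" and "finite X" and "finite Y"
  shows "cross_tiling N A B X Y \<longleftrightarrow>
    (\<forall>k\<in>{0..N-1}.
      (fourier N A k + fourier N B k) * (fourier N X k + fourier N Y k) =
        2 * (if k = 0 then of_int N else 0) \<and>
      (fourier N A k - fourier N B k) * (fourier N X k - fourier N Y k) = 0)"
  unfolding cross_tiling_def is_tiling_iff_fourier [OF assms]
    is_tiling_iff_fourier [OF assms(1-3) assms(5,4)] ball_conj_distrib [symmetric]
    cross_products_eq_iff ..

theorem mainTheorem3:
  fixes N :: int and A B X Y :: "int set"
  assumes "N > 1"
    and "A \<subseteq> carrier (residue_ring N)" and "B \<subseteq> carrier (residue_ring N)"
    and "X \<subseteq> carrier (residue_ring N)" and "Y \<subseteq> carrier (residue_ring N)"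
  shows "(cross_tiling N A B X Y \<longleftrightarrow>
            (fourier N A 0 + fourier N B 0) * (fourier N X 0 + fourier N Y 0) = 2 * of_int N \<and>
            (\<forall>k \<in> carrier (residue_ring N) - {0}.
               fourier N A k \<noteq> - fourier N B k \<longrightarrow> fourier N X k = - fourier N Y k) \<and>
            (\<forall>k \<in> carrier (residue_ring N).
               fourier N A k \<noteq> fourier N B k \<longrightarrow> fourier N X k = fourier N Y k)) \<and>
         (cross_tiling N A B X Y \<longrightarrow> card A = card B \<or> card X = card Y)"
proof -
  have carrier: "carrier (residue_ring N) = {0..N-1}"
    by (simp add: residue_ring_def)
  have N: "N > 0" and zero: "0 \<in> {0..N-1}"
    using assms(1) by auto
  have fin: "finite A" "finite B" "finite X" "finite Y"
    using assms(2-5) unfolding carrier by (meson finite_atLeastAtMost_int finite_subset)+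
  have fourier_0: "fourier N S 0 = of_nat (card S)" for S
    by (simp add: fourier_eq_sum_zchar)
  note iff = cross_tiling_iff_fourier [OF N fin]
  have "cross_tiling N A B X Y \<longleftrightarrow>
      (fourier N A 0 + fourier N B 0) * (fourier N X 0 + fourier N Y 0) = 2 * of_int N \<and>
      (\<forall>k\<in>{0..N-1} - {0}. (fourier N A k + fourier N B k) * (fourier N X k + fourier N Y k) = 0) \<and>
      (\<forall>k\<in>{0..N-1}. (fourier N A k - fourier N B k) * (fourier N X k - fourier N Y k) = 0)"
    unfolding iff using zero by (auto split: if_splits)
  \<comment> \<open>At frequency 0 the transforms are cardinalities, so the difference equation is a
    vanishing product of differences of cardinalities.\<close>
  moreover have "card A = card B \<or> card X = card Y" if "cross_tiling N A B X Y"
    using that zero unfolding iff by (auto simp: fourier_0 dest: bspec [of _ _ 0])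
  \<comment> \<open>A product of complex numbers vanishes iff a factor does; each such disjunction
    is read as an implication.\<close>
  ultimately show ?thesis
    unfolding carrier by (simp add: eq_neg_iff_add_eq_0 disj_imp)
qed

end
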